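(* Let $S$ be a numerical semigroup with multiplicity three, and let $\mathcal{T}_3$ be the tree of numerical semigroups with multiplicity three. Then: 1. $S$ is a leaf in $\mathcal{T}_3$ if and only if $S$ has embedding dimension two. 2. $S$ has exactly one child in $\mathcal{T}_3$ if and only if $S$ has maximal embedding dimension and $\mathrm{F}(S)>\frac{3\,\mathrm{g}(S)}{2}$. 3. $S$ has exactly two children in $\mathcal{T}_3$ if and only if $S$ has maximal embedding dimension and $\mathrm{F}(S)<\frac{3\,\mathrm{g}(S)}{2}$. Moreover, for every fixed genus $g\ge 5$: (i) there is a numerical semigroup with multiplicity three, embedding dimension three and genus $g$ with two children in $\mathcal{T}_3$; (ii) there is a numerical semigroup with multiplicity three, embedding dimension two and genus $g$ (hence a leaf in $\mathcal{T}_3$) if and only if $g \bmod 3\in\{0,1\}$; (iii) there are one or more numerical semigroups with multiplicity three, embedding dimension three and genus $g$ with one child in $\mathcal{T}_3$. In particular, for $g\ge 5$, \[\#\mathcal{S}(3,g+1)=\begin{cases}\#\mathcal{S}(3,g), & \text{if } g\bmod 3\in\{0,1\},\\ \#\mathcal{S}(3,g)+1, & \text{otherwise}.\end{cases}\]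
   Context: A numerical semigroup is a submonoid $S$ of $(\mathbb{N},+)$ with $\mathbb{N}\setminus S$ finite. Its multiplicity is its least positive element; its embedding dimension is the cardinality of its unique minimal generating system; maximal embedding dimension means embedding dimension equal to the multiplicity; its genus $\mathrm{g}(S)=\#(\mathbb{N}\setminus S)$; its Frobenius number $\mathrm{F}(S)=\max(\mathbb{N}\setminus S)$. The tree of numerical semigroups has root $\mathbb{N}$ and the children of a numerical semigroup $T$ are the semigroups $T\setminus\{x\}$ with $x$ a minimal generator of $T$ satisfying $x>\mathrm{F}(T)$. The tree $\mathcal{T}_3$ is the subtree whose vertices are the numerical semigroups of multiplicity three (so the children of $S$ in $\mathcal{T}_3$ are its children of multiplicity three); a leaf is a vertex with no children. $\mathcal{S}(3,g)$ denotes the set of numerical semigroups with multiplicity three and genus $g$. *)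

theory Defs
  imports Complex_Main
begin

definition nat_submonoid :: "nat set \<Rightarrow> bool" where
  "nat_submonoid S \<longleftrightarrow> 0 \<in> S \<and> (\<forall>a\<in>S. \<forall>b\<in>S. a + b \<in> S)"

definition numerical_semigroup :: "nat set \<Rightarrow> bool" where
  "numerical_semigroup S \<longleftrightarrow> nat_submonoid S \<and> finite (- S)"

definition ns_multiplicity :: "nat set \<Rightarrow> nat" where
  "ns_multiplicity S = (LEAST x. x \<in> S \<and> 0 < x)"

definition ns_genus :: "nat set \<Rightarrow> nat" where
  "ns_genus S = card (- S)"

text \<open>
  The set of gaps is empty exactly for the root of the tree, where the usual convention
  is that the Frobenius number is \<open>-1\<close>; hence the integer result type.
\<close>

definition ns_frobenius :: "nat set \<Rightarrow> int" where
  "ns_frobenius S = (if S = UNIV then - 1 else int (Max (- S)))"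

definition minimal_generating_system :: "nat set \<Rightarrow> nat set \<Rightarrow> bool" where
  "minimal_generating_system S A \<longleftrightarrow>
     nat_submonoid hull A = S \<and> (\<forall>B. B \<subset> A \<longrightarrow> nat_submonoid hull B \<noteq> S)"

text \<open>
  The definite description is justified by the lemma
  \<open>ex1_minimal_generating_system\<close> below.
\<close>

definition minimal_generators :: "nat set \<Rightarrow> nat set" where
  "minimal_generators S = (THE A. minimal_generating_system S A)"

definition embedding_dimension :: "nat set \<Rightarrow> nat" where
  "embedding_dimension S = card (minimal_generators S)"

definition maximal_embedding_dimension :: "nat set \<Rightarrow> bool" where
  "maximal_embedding_dimension S \<longleftrightarrow> embedding_dimension S = ns_multiplicity S"

text \<open>
  A tree is represented by its set of (parent, child) pairs.
\<close>

definition semigroup_tree :: "(nat set \<times> nat set) set" where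
  "semigroup_tree =
     {(T, T - {x}) | T x. numerical_semigroup T \<and>
        x \<in> minimal_generators T \<and> int x > ns_frobenius T}"

definition semigroups_of_multiplicity :: "nat \<Rightarrow> nat set set" where
  "semigroups_of_multiplicity m = {S. numerical_semigroup S \<and> ns_multiplicity S = m}"

definition multiplicity_tree :: "nat \<Rightarrow> (nat set \<times> nat set) set" where
  "multiplicity_tree m =
     semigroup_tree \<inter> semigroups_of_multiplicity m \<times> semigroups_of_multiplicity m"

definition tree_children :: "nat \<Rightarrow> nat set \<Rightarrow> nat set set" where
  "tree_children m S = multiplicity_tree m `` {S}"

definition tree_leaf :: "nat \<Rightarrow> nat set \<Rightarrow> bool" where
  "tree_leaf m S \<longleftrightarrow> S \<in> semigroups_of_multiplicity m \<and> tree_children m S = {}"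

definition semigroups_mg :: "nat \<Rightarrow> nat \<Rightarrow> nat set set" where
  "semigroups_mg m g = {S \<in> semigroups_of_multiplicity m. ns_genus S = g}"

lemma nat_submonoid_hull: "nat_submonoid (nat_submonoid hull A)"
  by (rule hull_in) (auto simp: nat_submonoid_def)

lemma ex1_minimal_generating_system:
  assumes S: "nat_submonoid S"
  shows "\<exists>!A. minimal_generating_system S A"
proof -
  define M where "M = {x \<in> S. x \<noteq> 0 \<and> (\<forall>a\<in>S - {0}. \<forall>b\<in>S - {0}. x \<noteq> a + b)}"
  have sub: "M \<subseteq> A" if A: "nat_submonoid hull A = S" for A
  proof
    fix x assume x: "x \<in> M"
    show "x \<in> A"
    proof (rule ccontr)
      assume "x \<notin> A"
      have "A \<subseteq> S" using A hull_subset[of A nat_submonoid] by simp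
      with \<open>x \<notin> A\<close> have "A \<subseteq> S - {x}" by blast
      moreover have "nat_submonoid (S - {x})"
        unfolding nat_submonoid_def
      proof (intro conjI ballI)
        show "0 \<in> S - {x}" using S x by (simp add: nat_submonoid_def M_def)
        fix a b assume ab: "a \<in> S - {x}" "b \<in> S - {x}"
        have "a + b \<noteq> x"
        proof (cases "a = 0 \<or> b = 0")
          case True
          then show ?thesis using ab by auto
        next
          case False
          then show ?thesis using ab x by (auto simp: M_def)
        qed
        then show "a + b \<in> S - {x}" using S ab by (simp add: nat_submonoid_def)
      qed
      ultimately have "nat_submonoid hull A \<subseteq> S - {x}" by (rule hull_minimal)
      with A x show False by (auto simp: M_def)
    qed
  qed
  have gen: "x \<in> nat_submonoid hull M" if "x \<in> S" for x
    using that
  proof (induction x rule: less_induct)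
    case (less x)
    show ?case
    proof (cases "x = 0 \<or> x \<in> M")
      case True
      then show ?thesis
        using nat_submonoid_hull[of M] hull_subset[of M nat_submonoid]
        by (auto simp: nat_submonoid_def[of "nat_submonoid hull M"])
    next
      case False
      then obtain a b where ab: "a \<in> S - {0}" "b \<in> S - {0}" "x = a + b"
        using less.prems unfolding M_def by blast
      then have "a \<in> nat_submonoid hull M" "b \<in> nat_submonoid hull M"
        using less.IH by auto
      then show ?thesis
        using nat_submonoid_hull[of M] ab
        by (auto simp: nat_submonoid_def[of "nat_submonoid hull M"])
    qed
  qed
  have "nat_submonoid hull M \<subseteq> S"
    by (rule hull_minimal) (auto simp: M_def S)
  with gen have MS: "nat_submonoid hull M = S" by blast
  show ?thesis
  proof (rule ex1I[of _ M])
    show "minimal_generating_system S M"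
      using MS sub by (auto simp: minimal_generating_system_def)
    show "A = M" if "minimal_generating_system S A" for A
      using that MS sub[of A] by (auto simp: minimal_generating_system_def)
  qed
qed

lemma finite_semigroups_mg: "finite (semigroups_mg m g)"
proof -
  have "S \<in> uminus ` Pow {..<2 * g}" if "S \<in> semigroups_mg m g" for S
  proof -
    have S: "nat_submonoid S" and fin: "finite (- S)" and g: "card (- S) = g"
      using that by (auto simp: semigroups_mg_def semigroups_of_multiplicity_def
          numerical_semigroup_def ns_genus_def)
    have "x < 2 * g" if x: "x \<in> - S" for x
    proof -
      have "i \<in> - S \<union> (\<lambda>i. x - i) ` (- S)" if "i \<le> x" for i
      proof (rule ccontr)
        assume *: "i \<notin> - S \<union> (\<lambda>i. x - i) ` (- S)"
        have "x - i \<in> S"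
        proof (rule ccontr)
          assume "x - i \<notin> S"
          then have "x - (x - i) \<in> (\<lambda>i. x - i) ` (- S)" by (intro imageI) simp
          with * that show False by simp
        qed
        moreover have "i \<in> S" using * by simp
        ultimately have "i + (x - i) \<in> S" using S by (auto simp: nat_submonoid_def)
        with x that show False by simp
      qed
      then have "{..x} \<subseteq> - S \<union> (\<lambda>i. x - i) ` (- S)" by auto
      then have "card {..x} \<le> card (- S \<union> (\<lambda>i. x - i) ` (- S))"
        using fin by (intro card_mono) auto
      also have "\<dots> \<le> card (- S) + card ((\<lambda>i. x - i) ` (- S))" by (rule card_Un_le)
      also have "\<dots> \<le> g + g" using g card_image_le[OF fin, of "\<lambda>i. x - i"] by simp
      finally show ?thesis by simp
    qed
    then have "- S \<in> Pow {..<2 * g}" by auto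
    then show ?thesis by (metis double_complement imageI)
  qed
  then have "semigroups_mg m g \<subseteq> uminus ` Pow {..<2 * g}" by blast
  then show ?thesis by (rule finite_subset) simp
qed

end

(* A numerical semigroup of multiplicity three is determined by its least elements 3p + 1 and
   3q + 2 in the two nonzero residue classes modulo 3; conversely p, q \<ge> 1 occur exactly when
   q \<le> 2p and p \<le> 2q + 1. The genus is p + q, the Frobenius number is
   max (3p - 2) (3q - 1), the minimal generators are 3, and 3p + 1 unless p = 2q + 1, and
   3q + 2 unless q = 2p. Removing one of the last two generators increments p or q. Everything
   thus becomes linear arithmetic in p and q. *)

theory Submission
  imports Defs
begin

section \<open>Minimal generators\<close>

text \<open>The atoms of the monoid. Naming them replaces the definite description in
  \<open>minimal_generators\<close> by a set that can be computed.\<close>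

definition irreducibles :: "nat set \<Rightarrow> nat set" where
  "irreducibles S = {x \<in> S. x \<noteq> 0 \<and> (\<forall>a\<in>S - {0}. \<forall>b\<in>S - {0}. x \<noteq> a + b)}"

text \<open>Deleting an atom leaves a submonoid, so generators that avoid the atom cannot produce
  it.\<close>

lemma irreducibles_subset_generators:
  assumes S: "nat_submonoid S" and A: "nat_submonoid hull A = S"
  shows "irreducibles S \<subseteq> A"
proof
  fix x assume x: "x \<in> irreducibles S"
  show "x \<in> A"
  proof (rule ccontr)
    assume "x \<notin> A"
    moreover have "A \<subseteq> S" using A hull_subset[of A nat_submonoid] by simp
    ultimately have "A \<subseteq> S - {x}" by blast
    moreover have "nat_submonoid (S - {x})"
    proof -
      have "a + b \<noteq> x" if "a \<in> S - {x}" "b \<in> S - {x}" for a b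
        using that x by (cases "a = 0 \<or> b = 0") (auto simp: irreducibles_def)
      then show ?thesis
        using S x by (auto simp: nat_submonoid_def irreducibles_def)
    qed
    ultimately have "nat_submonoid hull A \<subseteq> S - {x}" by (rule hull_minimal)
    with A x show False by (auto simp: irreducibles_def)
  qed
qed

text \<open>Strong induction: a nonzero element that is not an atom is a sum of two nonzero, hence
  smaller, elements.\<close>

lemma hull_irreducibles:
  assumes S: "nat_submonoid S"
  shows "nat_submonoid hull irreducibles S = S"
proof
  let ?H = "nat_submonoid hull irreducibles S"
  show "?H \<subseteq> S"
    by (rule hull_minimal) (auto simp: irreducibles_def S)
  have H: "0 \<in> ?H" "\<And>a b. a \<in> ?H \<Longrightarrow> b \<in> ?H \<Longrightarrow> a + b \<in> ?H"
    using nat_submonoid_hull[of "irreducibles S"] by (auto simp: nat_submonoid_def[of ?H])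
  have "x \<in> ?H" if "x \<in> S" for x
    using that
  proof (induction x rule: less_induct)
    case (less x)
    show ?case
    proof (cases "x = 0 \<or> x \<in> irreducibles S")
      case True
      then show ?thesis
        using H(1) hull_subset[of "irreducibles S" nat_submonoid] by auto
    next
      case False
      then obtain a b where "a \<in> S - {0}" "b \<in> S - {0}" "x = a + b"
        using less.prems unfolding irreducibles_def by blast
      then show ?thesis using less.IH H(2) by auto
    qed
  qed
  then show "S \<subseteq> ?H" by blast
qed

text \<open>The atoms generate and lie in every generating set, so no proper subset of them
  generates; uniqueness does the rest.\<close>

lemma minimal_generators_eq_irreducibles:
  assumes "nat_submonoid S"
  shows "minimal_generators S = irreducibles S"
  unfolding minimal_generators_def
proof (rule the1_equality)
  show "\<exists>!A. minimal_generating_system S A"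
    by (rule ex1_minimal_generating_system[OF assms])
  show "minimal_generating_system S (irreducibles S)"
    using hull_irreducibles[OF assms] irreducibles_subset_generators[OF assms]
    by (auto simp: minimal_generating_system_def)
qed

section \<open>Coordinates on semigroups of multiplicity three\<close>

text \<open>Under \<open>kunz3\<close>, the pair \<open>(p, q)\<close> consists of the Kunz
  coordinates, and \<open>0\<close>, \<open>3 * p + 1\<close>, \<open>3 * q + 2\<close> form the
  Apery set with respect to 3. For arbitrary \<open>p\<close> and \<open>q\<close> the set need not
  be closed under addition.\<close>

definition semigroup3 :: "nat \<Rightarrow> nat \<Rightarrow> nat set" where
  "semigroup3 p q =
     {x. x mod 3 = 0 \<or> x mod 3 = 1 \<and> 3 * p + 1 \<le> x \<or> x mod 3 = 2 \<and> 3 * q + 2 \<le> x}"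

text \<open>The lower bounds keep 1 and 2 out. The other two conditions make twice
  \<open>3 * p + 1\<close>, which is \<open>3 * (2 * p) + 2\<close>, and twice
  \<open>3 * q + 2\<close>, which is \<open>3 * (2 * q + 1) + 1\<close>, members.\<close>

definition kunz3 :: "nat \<Rightarrow> nat \<Rightarrow> bool" where
  "kunz3 p q \<longleftrightarrow> 1 \<le> p \<and> 1 \<le> q \<and> q \<le> 2 * p \<and> p \<le> 2 * q + 1"

lemma mem_semigroup3:
  "x \<in> semigroup3 p q \<longleftrightarrow>
     x mod 3 = 0 \<or> x mod 3 = 1 \<and> 3 * p + 1 \<le> x \<or> x mod 3 = 2 \<and> 3 * q + 2 \<le> x"
  by (simp add: semigroup3_def)

section \<open>Residue classes modulo three\<close>

lemma nat_mod_3_cases: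
  fixes x :: nat
  obtains (zero) i where "x = 3 * i" | (one) i where "x = 3 * i + 1" | (two) i where "x = 3 * i + 2"
proof -
  have "x = 3 * (x div 3) \<or> x = 3 * (x div 3) + 1 \<or> x = 3 * (x div 3) + 2" by presburger
  then show thesis using that by metis
qed

lemma nat_mod_3_simps:
  "3 * i mod 3 = (0::nat)" "(3 * i + 1) mod 3 = (1::nat)" "(3 * i + 2) mod 3 = (2::nat)"
  by presburger+

lemma nat_mod_3_distinct:
  fixes i j :: nat
  shows "3 * i \<noteq> 3 * j + 1" "3 * i \<noteq> 3 * j + 2" "3 * i + 1 \<noteq> 3 * j + 2"
    "3 * j + 1 \<noteq> 3 * i" "3 * j + 2 \<noteq> 3 * i" "3 * j + 2 \<noteq> 3 * i + 1"
  by presburger+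

lemma nat_mod_3_inject:
  fixes i j :: nat
  shows "3 * i + 1 = 3 * j + 1 \<longleftrightarrow> i = j" "3 * i + 2 = 3 * j + 2 \<longleftrightarrow> i = j"
  by simp_all

text \<open>Sums return to the shape on which membership is decided; the extra 1 in the quotient is
  the carry from residues adding up to 3 or 4.\<close>

lemma nat_mod_3_add:
  fixes i j :: nat
  shows "3 * i + 3 * j = 3 * (i + j)"
    "3 * i + (3 * j + 1) = 3 * (i + j) + 1" "3 * i + (3 * j + 2) = 3 * (i + j) + 2"
    "(3 * i + 1) + 3 * j = 3 * (i + j) + 1" "(3 * i + 2) + 3 * j = 3 * (i + j) + 2"
    "(3 * i + 1) + (3 * j + 1) = 3 * (i + j) + 2" "(3 * i + 1) + (3 * j + 2) = 3 * (i + j + 1)"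
    "(3 * i + 2) + (3 * j + 1) = 3 * (i + j + 1)" "(3 * i + 2) + (3 * j + 2) = 3 * (i + j + 1) + 1"
  by simp_all

text \<open>Eliminates \<open>mod\<close>: membership becomes a comparison of quotients, within
  reach of linear arithmetic.\<close>

lemma semigroup3_least_elements:
  "3 * i \<in> semigroup3 p q"
  "3 * i + 1 \<in> semigroup3 p q \<longleftrightarrow> p \<le> i"
  "3 * i + 2 \<in> semigroup3 p q \<longleftrightarrow> q \<le> i"
  unfolding mem_semigroup3 nat_mod_3_simps by simp_all

lemma semigroup3_cases [consumes 1]:
  assumes "x \<in> semigroup3 p q"
  obtains (zero) i where "x = 3 * i"
    | (one) i where "x = 3 * i + 1" "p \<le> i"
    | (two) i where "x = 3 * i + 2" "q \<le> i"
  using assms by (cases x rule: nat_mod_3_cases) (use that semigroup3_least_elements in metis)+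

text \<open>Testing membership of \<open>3 * i + 1\<close> at \<open>i = p\<close> and
  \<open>i = p'\<close> gives both inequalities between \<open>p\<close> and \<open>p'\<close>;
  likewise for \<open>q\<close>.\<close>

lemma semigroup3_eq_iff: "semigroup3 p q = semigroup3 p' q' \<longleftrightarrow> p = p' \<and> q = q'"
  by (metis semigroup3_least_elements le_antisym order_refl)

section \<open>Gaps, genus and Frobenius number\<close>

lemma Compl_semigroup3:
  "- semigroup3 p q = (\<lambda>i. 3 * i + 1) ` {..<p} \<union> (\<lambda>i. 3 * i + 2) ` {..<q}"
proof (intro set_eqI iffI)
  fix x assume "x \<in> - semigroup3 p q"
  then show "x \<in> (\<lambda>i. 3 * i + 1) ` {..<p} \<union> (\<lambda>i. 3 * i + 2) ` {..<q}"
    by (cases x rule: nat_mod_3_cases) (auto simp: semigroup3_least_elements[simplified] not_le)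
qed (auto simp: semigroup3_least_elements[simplified])

lemma finite_Compl_semigroup3: "finite (- semigroup3 p q)"
  unfolding Compl_semigroup3 by simp

lemma ns_genus_semigroup3: "ns_genus (semigroup3 p q) = p + q"
proof -
  have "(\<lambda>i. 3 * i + 1) ` {..<p} \<inter> (\<lambda>i. 3 * i + 2) ` {..<q} = {}"
    using nat_mod_3_distinct(3) by blast
  then show ?thesis
    unfolding ns_genus_def Compl_semigroup3
    by (subst card_Un_disjoint) (auto simp: card_image inj_on_def)
qed

text \<open>The largest gaps in the classes of 1 and 2 are \<open>3 * (p - 1) + 1\<close> and
  \<open>3 * (q - 1) + 2\<close>; both exist because \<open>p\<close> and \<open>q\<close> are
  positive.\<close>

lemma ns_frobenius_semigroup3:
  assumes "1 \<le> p" "1 \<le> q"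
  shows "ns_frobenius (semigroup3 p q) = max (3 * int p - 2) (3 * int q - 1)"
proof -
  have "Max (- semigroup3 p q) = max (3 * p - 2) (3 * q - 1)"
  proof (rule Max_eqI[OF finite_Compl_semigroup3])
    show "y \<le> max (3 * p - 2) (3 * q - 1)" if "y \<in> - semigroup3 p q" for y
      using that unfolding Compl_semigroup3 by auto
    have "3 * p - 2 = 3 * (p - 1) + 1" "3 * q - 1 = 3 * (q - 1) + 2"
      using assms by simp_all
    then have "3 * p - 2 \<in> - semigroup3 p q" "3 * q - 1 \<in> - semigroup3 p q"
      using assms by (simp_all only: Compl_iff semigroup3_least_elements)
    then show "max (3 * p - 2) (3 * q - 1) \<in> - semigroup3 p q"
      by (simp add: max_def)
  qed
  moreover have "1 \<notin> semigroup3 p q" using assms by (simp add: mem_semigroup3)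
  then have "semigroup3 p q \<noteq> UNIV" by blast
  ultimately show ?thesis
    using assms by (simp add: ns_frobenius_def of_nat_max of_nat_diff)
qed

text \<open>Of the nine pairs of residues only 1 + 1 and 2 + 2 are critical, and they are covered by
  the two Kunz inequalities. Adding a multiple of 3 keeps the class and does not decrease the
  quotient, and 1 + 2 lands in the class of 0.\<close>

lemma nat_submonoid_semigroup3:
  assumes "kunz3 p q"
  shows "nat_submonoid (semigroup3 p q)"
proof -
  have bounds: "q \<le> 2 * p" "p \<le> 2 * q + 1" using assms by (auto simp: kunz3_def)
  have "a + b \<in> semigroup3 p q" if a: "a \<in> semigroup3 p q" and b: "b \<in> semigroup3 p q" for a b
    using a
    by (cases rule: semigroup3_cases; use b in \<open>cases rule: semigroup3_cases\<close>)
      (simp_all only: nat_mod_3_add semigroup3_least_elements, (use bounds in linarith)+)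
  then show ?thesis by (simp add: nat_submonoid_def mem_semigroup3)
qed

lemma semigroup3_ge_3:
  assumes "1 \<le> p" "1 \<le> q" "x \<in> semigroup3 p q" "x \<noteq> 0"
  shows "3 \<le> x"
  using assms(3) by (cases rule: semigroup3_cases) (use assms(1,2,4) in auto)

lemma ns_multiplicity_semigroup3:
  assumes "1 \<le> p" "1 \<le> q"
  shows "ns_multiplicity (semigroup3 p q) = 3"
  unfolding ns_multiplicity_def
proof (rule Least_equality)
  show "3 \<in> semigroup3 p q \<and> (0::nat) < 3" by (simp add: mem_semigroup3)
  show "3 \<le> x" if "x \<in> semigroup3 p q \<and> 0 < x" for x
    using semigroup3_ge_3[OF assms] that by blast
qed

lemma semigroup3_of_multiplicity:
  assumes "kunz3 p q"
  shows "semigroup3 p q \<in> semigroups_of_multiplicity 3"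
proof -
  have "ns_multiplicity (semigroup3 p q) = 3"
    by (rule ns_multiplicity_semigroup3) (use assms in \<open>simp_all add: kunz3_def\<close>)
  then show ?thesis
    using nat_submonoid_semigroup3[OF assms] finite_Compl_semigroup3[of p q]
    by (simp add: semigroups_of_multiplicity_def numerical_semigroup_def)
qed

section \<open>Existence of the coordinates\<close>

lemma eventually_periodic_threshold:
  fixes S :: "nat set"
  assumes fin: "finite (- S)" and add: "\<And>x. x \<in> S \<Longrightarrow> x + 3 \<in> S"
  obtains k where "\<And>x. x mod 3 = r mod 3 \<Longrightarrow> r \<le> x \<Longrightarrow> x \<in> S \<longleftrightarrow> 3 * k + r \<le> x"
proof -
  \<comment> \<open>An infinite progression cannot lie inside the finite set of gaps, so the class
    of \<open>r\<close> meets \<open>S\<close>.\<close>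
  have "infinite (range (\<lambda>i. 3 * i + r))"
    by (simp add: finite_image_iff inj_def)
  then have "\<not> range (\<lambda>i. 3 * i + r) \<subseteq> - S"
    using fin finite_subset by metis
  then obtain i where "3 * i + r \<in> S" by blast
  define k where "k = (LEAST i. 3 * i + r \<in> S)"
  have k: "3 * k + r \<in> S" and least: "\<And>i. 3 * i + r \<in> S \<Longrightarrow> k \<le> i"
    unfolding k_def using \<open>3 * i + r \<in> S\<close> by (auto intro: LeastI Least_le)
  have up: "3 * (k + j) + r \<in> S" for j
  proof (induction j)
    case (Suc j)
    then show ?case using add[of "3 * (k + j) + r"] by (simp add: algebra_simps)
  qed (use k in simp)
  show thesis
  proof (rule that)
    fix x assume "x mod 3 = r mod 3" "r \<le> x"
    then obtain i where i: "x = r + 3 * i" by (rule mod_eq_nat1E)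
    \<comment> \<open>Below index \<open>k\<close> minimality excludes membership; from
      \<open>k\<close> on, repeated addition of 3 gives it.\<close>
    show "x \<in> S \<longleftrightarrow> 3 * k + r \<le> x"
      using least[of i] up[of "i - k"] by (cases "k \<le> i") (auto simp: i add.commute)
  qed
qed

text \<open>Closure under adding 3 gives a threshold in each residue class, and the one in the class
  of 0 is trivial because 0 is a member.\<close>

lemma of_multiplicity3_imp_semigroup3:
  assumes "S \<in> semigroups_of_multiplicity 3"
  obtains p q where "kunz3 p q" "S = semigroup3 p q"
proof -
  have zero: "0 \<in> S" and add: "\<And>a b. a \<in> S \<Longrightarrow> b \<in> S \<Longrightarrow> a + b \<in> S"
    and fin: "finite (- S)" and mult: "(LEAST x. x \<in> S \<and> 0 < x) = 3"
    using assms by (auto simp: semigroups_of_multiplicity_def numerical_semigroup_def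
        nat_submonoid_def ns_multiplicity_def)
  \<comment> \<open>The value of \<open>LEAST\<close> is known to be a member of \<open>S\<close>
    only once some positive member exists.\<close>
  have "infinite S" using fin by (metis finite_compl infinite_UNIV_nat)
  then have "\<exists>x. x \<in> S \<and> 0 < x"
    by (metis finite.emptyI finite_insert finite_subset insertI1 neq0_conv subsetI)
  then have three: "3 \<in> S" using LeastI_ex[of "\<lambda>x. x \<in> S \<and> 0 < x"] mult by simp
  have small: "1 \<notin> S" "2 \<notin> S"
    using not_less_Least[of 1 "\<lambda>x. x \<in> S \<and> 0 < x"]
      not_less_Least[of 2 "\<lambda>x. x \<in> S \<and> 0 < x"] mult by simp_all
  have step: "x + 3 \<in> S" if "x \<in> S" for x using add[OF that three] .
  obtain k where k: "\<And>x. x mod 3 = 0 mod 3 \<Longrightarrow> 0 \<le> x \<Longrightarrow> x \<in> S \<longleftrightarrow> 3 * k + 0 \<le> x"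
    using eventually_periodic_threshold[OF fin step] by blast
  obtain p where p: "\<And>x. x mod 3 = 1 mod 3 \<Longrightarrow> 1 \<le> x \<Longrightarrow> x \<in> S \<longleftrightarrow> 3 * p + 1 \<le> x"
    using eventually_periodic_threshold[OF fin step] by blast
  obtain q where q: "\<And>x. x mod 3 = 2 mod 3 \<Longrightarrow> 2 \<le> x \<Longrightarrow> x \<in> S \<longleftrightarrow> 3 * q + 2 \<le> x"
    using eventually_periodic_threshold[OF fin step] by blast
  have "k = 0" using k[of 0] zero by simp
  have S: "S = semigroup3 p q"
  proof (rule set_eqI)
    fix x :: nat
    show "x \<in> S \<longleftrightarrow> x \<in> semigroup3 p q"
      using k[of x] p[of x] q[of x] \<open>k = 0\<close>
      by (cases x rule: nat_mod_3_cases)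
        (simp_all add: semigroup3_least_elements[simplified] nat_mod_3_simps[simplified])
  qed
  have "1 \<le> p" "1 \<le> q"
    using small semigroup3_least_elements[of 0 p q] by (simp_all add: S numeral_2_eq_2)
  \<comment> \<open>Doubling the least elements of the two classes yields the Kunz
    inequalities.\<close>
  moreover have "(3 * p + 1) + (3 * p + 1) \<in> S" "(3 * q + 2) + (3 * q + 2) \<in> S"
    by (rule add; simp add: S semigroup3_least_elements[simplified])+
  moreover have "(3 * p + 1) + (3 * p + 1) = 3 * (2 * p) + 2"
    "(3 * q + 2) + (3 * q + 2) = 3 * (2 * q + 1) + 1" by simp_all
  ultimately have "kunz3 p q"
    by (simp only: S semigroup3_least_elements kunz3_def)
  with S show thesis using that by blast
qed

lemma multiplicity3_cases:
  assumes "numerical_semigroup S" "ns_multiplicity S = 3"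
  obtains p q where "kunz3 p q" "S = semigroup3 p q"
  using assms of_multiplicity3_imp_semigroup3[of S]
  by (auto simp: semigroups_of_multiplicity_def)

section \<open>Invariants in terms of the coordinates\<close>

text \<open>An atom other than 3 stays in no smaller position of its class, so only the least
  elements of the classes of 1 and 2 remain; each is lost exactly when it is twice the
  other.\<close>

lemma minimal_generators_semigroup3:
  assumes pq: "kunz3 p q"
  shows "minimal_generators (semigroup3 p q) =
    {3} \<union> (if p \<le> 2 * q then {3 * p + 1} else {}) \<union> (if q < 2 * p then {3 * q + 2} else {})"
proof -
  let ?S = "semigroup3 p q"
  have bounds: "1 \<le> p" "1 \<le> q" "q \<le> 2 * p" "p \<le> 2 * q + 1"
    using pq by (auto simp: kunz3_def)
  have only: "x = 3 \<or> x = 3 * p + 1 \<and> p \<le> 2 * q \<or> x = 3 * q + 2 \<and> q < 2 * p"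
    if "x \<in> irreducibles ?S" for x
  proof -
    have x: "x \<in> ?S" "x \<noteq> 0"
      and irr: "\<And>a b. a \<in> ?S \<Longrightarrow> b \<in> ?S \<Longrightarrow> a \<noteq> 0 \<Longrightarrow> b \<noteq> 0 \<Longrightarrow> x \<noteq> a + b"
      using that by (auto simp: irreducibles_def)
    have "3 \<le> x" by (rule semigroup3_ge_3[OF bounds(1,2) x])
    \<comment> \<open>Otherwise \<open>3 + (x - 3)\<close> splits \<open>x\<close> into two nonzero
      members.\<close>
    have "x = 3 \<or> x - 3 \<notin> ?S"
      using irr[of 3 "x - 3"] \<open>3 \<le> x\<close> by (auto simp: mem_semigroup3[of 3])
    with x(1) have "x = 3 \<or> x = 3 * p + 1 \<or> x = 3 * q + 2"
    proof (cases rule: semigroup3_cases)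
      case (zero i)
      then have "x - 3 = 3 * (i - 1)" using \<open>3 \<le> x\<close> by simp
      then have "x - 3 \<in> ?S" by (simp add: mem_semigroup3)
      then show ?thesis using \<open>x = 3 \<or> x - 3 \<notin> ?S\<close> by simp
    next
      case (one i)
      then have "x - 3 = 3 * (i - 1) + 1" using \<open>3 \<le> x\<close> by simp
      then have "x = 3 \<or> \<not> p \<le> i - 1"
        using \<open>x = 3 \<or> x - 3 \<notin> ?S\<close> semigroup3_least_elements(2) by metis
      then show ?thesis using one by auto
    next
      case (two i)
      then have "x = 3 * q + 2 \<or> x - 3 = 3 * (i - 1) + 2 \<and> q \<le> i - 1" using \<open>3 \<le> x\<close> by auto
      then show ?thesis
        using \<open>x = 3 \<or> x - 3 \<notin> ?S\<close> semigroup3_least_elements(3) by metis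
    qed
    \<comment> \<open>If \<open>p \<le> 2 * q\<close> fails, then \<open>p = 2 * q + 1\<close> and
      \<open>3 * p + 1\<close> is twice \<open>3 * q + 2\<close>; if \<open>q < 2 * p\<close> fails,
      then \<open>q = 2 * p\<close> and \<open>3 * q + 2\<close> is twice
      \<open>3 * p + 1\<close>.\<close>
    moreover have "x \<noteq> (3 * p + 1) + (3 * p + 1)" "x \<noteq> (3 * q + 2) + (3 * q + 2)"
      by (rule irr; simp add: semigroup3_least_elements[simplified])+
    ultimately show ?thesis using bounds by auto
  qed
  \<comment> \<open>A sum of two nonzero members is at least 6.\<close>
  have irr3: "3 \<in> irreducibles ?S"
    using semigroup3_ge_3[OF bounds(1,2)]
    by (fastforce simp: irreducibles_def mem_semigroup3[of 3])
  \<comment> \<open>Residue 1 arises as 0 + 1, too large by a positive multiple of 3, or as 2 + 2,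
    which is at least \<open>3 * (2 * q + 1) + 1\<close>.\<close>
  have irr1: "3 * p + 1 \<in> irreducibles ?S" if "p \<le> 2 * q"
  proof -
    have "3 * p + 1 \<noteq> a + b" if a: "a \<in> ?S" "0 < a" and b: "b \<in> ?S" "0 < b" for a b
      using a(1)
      by (cases rule: semigroup3_cases; use b(1) in \<open>cases rule: semigroup3_cases\<close>)
        (use a(2) b(2) \<open>p \<le> 2 * q\<close> in \<open>linarith | simp only: nat_mod_3_add nat_mod_3_distinct not_False_eq_True\<close>)+
    then show ?thesis using semigroup3_least_elements(2)[of p p q]
      by (auto simp: irreducibles_def)
  qed
  \<comment> \<open>Here the critical sum is 1 + 1, at least \<open>3 * (2 * p) + 2\<close>.\<close>
  have irr2: "3 * q + 2 \<in> irreducibles ?S" if "q < 2 * p"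
  proof -
    have "3 * q + 2 \<noteq> a + b" if a: "a \<in> ?S" "0 < a" and b: "b \<in> ?S" "0 < b" for a b
      using a(1)
      by (cases rule: semigroup3_cases; use b(1) in \<open>cases rule: semigroup3_cases\<close>)
        (use a(2) b(2) \<open>q < 2 * p\<close> in \<open>linarith | simp only: nat_mod_3_add nat_mod_3_distinct not_False_eq_True\<close>)+
    then show ?thesis using semigroup3_least_elements(3)[of q p q]
      by (auto simp: irreducibles_def)
  qed
  have "irreducibles ?S =
    {3} \<union> (if p \<le> 2 * q then {3 * p + 1} else {}) \<union> (if q < 2 * p then {3 * q + 2} else {})"
    (is "_ = ?R")
  proof
    show "irreducibles ?S \<subseteq> ?R" using only by fastforce
    show "?R \<subseteq> irreducibles ?S" using irr1 irr2 irr3 by auto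
  qed
  then show ?thesis
    using minimal_generators_eq_irreducibles[OF nat_submonoid_semigroup3[OF pq]] by simp
qed

text \<open>\<open>p = 2 * q + 1\<close> and \<open>q = 2 * p\<close> exclude each other, so at most
  one of the three candidates is lost.\<close>

lemma embedding_dimension_semigroup3:
  assumes "kunz3 p q"
  shows "embedding_dimension (semigroup3 p q) = (if p \<le> 2 * q \<and> q < 2 * p then 3 else 2)"
proof -
  have "3 * p + 1 \<noteq> 3 * q + 2" by presburger
  with assms show ?thesis
    unfolding embedding_dimension_def minimal_generators_semigroup3[OF assms] kunz3_def
    by auto
qed

section \<open>Children in the tree of multiplicity three\<close>

lemma semigroup3_remove:
  "semigroup3 p q - {3 * p + 1} = semigroup3 (p + 1) q"
  "semigroup3 p q - {3 * q + 2} = semigroup3 p (q + 1)"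
proof -
  have "x \<in> semigroup3 p q - {3 * p + 1} \<longleftrightarrow> x \<in> semigroup3 (p + 1) q"
    "x \<in> semigroup3 p q - {3 * q + 2} \<longleftrightarrow> x \<in> semigroup3 p (q + 1)" for x
    by (cases x rule: nat_mod_3_cases;
        simp only: Diff_iff singleton_iff semigroup3_least_elements nat_mod_3_distinct
          nat_mod_3_inject simp_thms; auto)+
  then show "semigroup3 p q - {3 * p + 1} = semigroup3 (p + 1) q"
    "semigroup3 p q - {3 * q + 2} = semigroup3 p (q + 1)" by blast+
qed

text \<open>In each condition one inequality says that the candidate is a minimal generator, the
  other that it exceeds the Frobenius number.\<close>

lemma tree_children_semigroup3:
  assumes pq: "kunz3 p q"
  shows "tree_children 3 (semigroup3 p q) =
    (if q \<le> p \<and> p \<le> 2 * q then {semigroup3 (p + 1) q} else {}) \<union>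
    (if p \<le> q + 1 \<and> q < 2 * p then {semigroup3 p (q + 1)} else {})"
proof -
  let ?S = "semigroup3 p q"
  have bounds: "1 \<le> p" "1 \<le> q" using pq by (auto simp: kunz3_def)
  have S: "?S \<in> semigroups_of_multiplicity 3" by (rule semigroup3_of_multiplicity[OF pq])
  have children: "tree_children 3 ?S = (\<lambda>x. ?S - {x}) ` {x \<in> minimal_generators ?S.
      int x > ns_frobenius ?S \<and> ?S - {x} \<in> semigroups_of_multiplicity 3}"
    using S by (auto simp: tree_children_def multiplicity_tree_def semigroup_tree_def
        semigroups_of_multiplicity_def)
  have frob: "int (3 * p + 1) > ns_frobenius ?S \<longleftrightarrow> q \<le> p"
    "int (3 * q + 2) > ns_frobenius ?S \<longleftrightarrow> p \<le> q + 1"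
    unfolding ns_frobenius_semigroup3[OF bounds] by auto
  \<comment> \<open>For \<open>p = q = 1\<close> the Frobenius number is 2, so 3 does exceed it; its
    removal is ruled out by the change of multiplicity.\<close>
  have no3: "?S - {3} \<notin> semigroups_of_multiplicity 3"
  proof
    assume "?S - {3} \<in> semigroups_of_multiplicity 3"
    then obtain p' q' where "?S - {3} = semigroup3 p' q'"
      by (rule of_multiplicity3_imp_semigroup3)
    moreover have "3 \<in> semigroup3 p' q'" by (simp add: mem_semigroup3)
    ultimately show False by blast
  qed
  \<comment> \<open>The generator condition \<open>p \<le> 2 * q\<close> is the Kunz inequality for
    the incremented \<open>p\<close>.\<close>
  have child1: "?S - {3 * p + 1} \<in> semigroups_of_multiplicity 3" if "q \<le> p" "p \<le> 2 * q"
    unfolding semigroup3_remove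
    by (rule semigroup3_of_multiplicity) (use pq that in \<open>auto simp: kunz3_def\<close>)
  have child2: "?S - {3 * q + 2} \<in> semigroups_of_multiplicity 3" if "p \<le> q + 1" "q < 2 * p"
    unfolding semigroup3_remove
    by (rule semigroup3_of_multiplicity) (use pq that in \<open>auto simp: kunz3_def\<close>)
  have gens: "x \<in> minimal_generators ?S \<longleftrightarrow>
      x = 3 \<or> x = 3 * p + 1 \<and> p \<le> 2 * q \<or> x = 3 * q + 2 \<and> q < 2 * p" for x
    unfolding minimal_generators_semigroup3[OF pq] by simp
  have "{x \<in> minimal_generators ?S.
      int x > ns_frobenius ?S \<and> ?S - {x} \<in> semigroups_of_multiplicity 3} =
    (if q \<le> p \<and> p \<le> 2 * q then {3 * p + 1} else {}) \<union>
    (if p \<le> q + 1 \<and> q < 2 * p then {3 * q + 2} else {})" (is "?L = ?R")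
  proof (rule set_eqI)
    fix x
    have "x \<in> ?L \<longleftrightarrow>
        x = 3 * p + 1 \<and> q \<le> p \<and> p \<le> 2 * q \<or> x = 3 * q + 2 \<and> p \<le> q + 1 \<and> q < 2 * p"
      unfolding mem_Collect_eq gens using frob no3 child1 child2 by metis
    moreover have "x \<in> ?R \<longleftrightarrow>
        x = 3 * p + 1 \<and> q \<le> p \<and> p \<le> 2 * q \<or> x = 3 * q + 2 \<and> p \<le> q + 1 \<and> q < 2 * p"
      by auto
    ultimately show "x \<in> ?L \<longleftrightarrow> x \<in> ?R" by (simp only:)
  qed
  then show ?thesis
    unfolding children by (simp only: image_Un if_distrib[of "image _"] image_insert image_empty
        semigroup3_remove)
qed

lemma card_tree_children_semigroup3:
  assumes "kunz3 p q"
  shows "card (tree_children 3 (semigroup3 p q)) =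
    (if q \<le> p \<and> p \<le> 2 * q then 1 else 0) + (if p \<le> q + 1 \<and> q < 2 * p then 1 else 0)"
  unfolding tree_children_semigroup3[OF assms] by (auto simp: semigroup3_eq_iff)

text \<open>One of \<open>q \<le> p\<close> and \<open>p \<le> q + 1\<close> always holds, so with
  both generators present there is a child. If one is missing, the other lies below the Frobenius
  number because \<open>p\<close> and \<open>q\<close> are positive.\<close>

lemma tree_leaf_semigroup3_iff:
  assumes "kunz3 p q"
  shows "tree_leaf 3 (semigroup3 p q) \<longleftrightarrow> embedding_dimension (semigroup3 p q) = 2"
  using assms semigroup3_of_multiplicity[OF assms]
  unfolding tree_leaf_def tree_children_semigroup3[OF assms]
    embedding_dimension_semigroup3[OF assms]
  by (auto simp: kunz3_def)

lemma maximal_embedding_dimension_semigroup3: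
  assumes "kunz3 p q"
  shows "maximal_embedding_dimension (semigroup3 p q) \<longleftrightarrow> p \<le> 2 * q \<and> q < 2 * p"
  using assms unfolding maximal_embedding_dimension_def embedding_dimension_semigroup3[OF assms]
  by (simp add: ns_multiplicity_semigroup3 kunz3_def)

text \<open>Twice the Frobenius number minus three times the genus is the larger of
  \<open>3 * (p - q) - 4\<close> and \<open>3 * (q - p) - 2\<close>, over the integers. Neither is a
  multiple of 3, so equality never occurs.\<close>

lemma frobenius_genus_semigroup3:
  assumes "kunz3 p q"
  shows "real_of_int (ns_frobenius (semigroup3 p q)) > 3 * real (ns_genus (semigroup3 p q)) / 2
      \<longleftrightarrow> q + 1 < p \<or> p < q"
    and "real_of_int (ns_frobenius (semigroup3 p q)) < 3 * real (ns_genus (semigroup3 p q)) / 2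
      \<longleftrightarrow> q \<le> p \<and> p \<le> q + 1"
proof -
  have cmp: "real_of_int f > 3 * real n / 2 \<longleftrightarrow> 2 * f > 3 * int n"
    "real_of_int f < 3 * real n / 2 \<longleftrightarrow> 2 * f < 3 * int n" for f n
    by linarith+
  have "1 \<le> p" "1 \<le> q" using assms by (auto simp: kunz3_def)
  then show "real_of_int (ns_frobenius (semigroup3 p q)) >
        3 * real (ns_genus (semigroup3 p q)) / 2 \<longleftrightarrow> q + 1 < p \<or> p < q"
    and "real_of_int (ns_frobenius (semigroup3 p q)) <
        3 * real (ns_genus (semigroup3 p q)) / 2 \<longleftrightarrow> q \<le> p \<and> p \<le> q + 1"
    unfolding cmp ns_genus_semigroup3 by (auto simp: ns_frobenius_semigroup3 max_def)
qed

section \<open>Counting by genus\<close>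

lemma semigroups_mg_3_eq:
  assumes "2 \<le> g"
  shows "semigroups_mg 3 g = (\<lambda>p. semigroup3 p (g - p)) ` {(g + 2) div 3..(2 * g + 1) div 3}"
proof (intro set_eqI iffI)
  fix S assume S: "S \<in> semigroups_mg 3 g"
  then obtain p q where pq: "kunz3 p q" "S = semigroup3 p q"
    using of_multiplicity3_imp_semigroup3 by (auto simp: semigroups_mg_def)
  then have g: "g = p + q" using S ns_genus_semigroup3 by (simp add: semigroups_mg_def)
  \<comment> \<open>With \<open>q = g - p\<close> the Kunz inequalities read
    \<open>g \<le> 3 * p\<close> and \<open>3 * p \<le> 2 * g + 1\<close>; the lower end of the
    interval is \<open>g / 3\<close> rounded up.\<close>
  with pq(1) have "p \<in> {(g + 2) div 3..(2 * g + 1) div 3}" by (auto simp: kunz3_def)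
  moreover have "S = semigroup3 p (g - p)" using g pq(2) by simp
  ultimately show "S \<in> (\<lambda>p. semigroup3 p (g - p)) ` {(g + 2) div 3..(2 * g + 1) div 3}"
    by blast
next
  fix S assume "S \<in> (\<lambda>p. semigroup3 p (g - p)) ` {(g + 2) div 3..(2 * g + 1) div 3}"
  then obtain p where p: "(g + 2) div 3 \<le> p" "p \<le> (2 * g + 1) div 3"
    and S: "S = semigroup3 p (g - p)" by auto
  have "g \<le> 3 * p" "3 * p \<le> 2 * g + 1" using p by auto
  then have "kunz3 p (g - p)" "p \<le> g" using assms by (auto simp: kunz3_def)
  then show "S \<in> semigroups_mg 3 g"
    unfolding S semigroups_mg_def using semigroup3_of_multiplicity
    by (simp add: ns_genus_semigroup3)
qed

lemma card_semigroups_mg_3: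
  assumes "2 \<le> g"
  shows "card (semigroups_mg 3 g) = (2 * g + 1) div 3 + 1 - (g + 2) div 3"
  unfolding semigroups_mg_3_eq[OF assms]
  by (subst card_image) (auto simp: inj_on_def semigroup3_eq_iff)

lemma kunz3_numerical_semigroup:
  assumes "kunz3 p q"
  shows "numerical_semigroup (semigroup3 p q)" "ns_multiplicity (semigroup3 p q) = 3"
  using semigroup3_of_multiplicity[OF assms] by (auto simp: semigroups_of_multiplicity_def)

section \<open>Witnesses of prescribed genus\<close>

lemma ex_semigroup3_two_children:
  assumes "2 \<le> g"
  shows "\<exists>S. numerical_semigroup S \<and> ns_multiplicity S = 3 \<and> embedding_dimension S = 3 \<and>
    ns_genus S = g \<and> card (tree_children 3 S) = 2"
proof -
  \<comment> \<open>Two children force \<open>q \<le> p \<le> q + 1\<close>, which leaves only the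
    balanced splitting of \<open>g\<close>.\<close>
  define p q where "p = (g + 1) div 2" and "q = g div 2"
  have *: "p + q = g" "1 \<le> q" "q \<le> p" "p \<le> q + 1"
    using assms unfolding p_def q_def by presburger+
  then have pq: "kunz3 p q" by (simp add: kunz3_def)
  show ?thesis
    using * kunz3_numerical_semigroup[OF pq] embedding_dimension_semigroup3[OF pq]
      ns_genus_semigroup3[of p q] card_tree_children_semigroup3[OF pq]
    by (intro exI[of _ "semigroup3 p q"]) auto
qed

text \<open>The witnesses lie just outside the band \<open>q \<le> p \<le> q + 1\<close>; the bound
  on \<open>g\<close> keeps both generators. For \<open>g = 4\<close> the even witness would be
  \<open>(3, 1)\<close>, where \<open>p \<le> 2 * q\<close> fails.\<close>

lemma ex_semigroup3_one_child:
  assumes "5 \<le> g"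
  shows "\<exists>S. numerical_semigroup S \<and> ns_multiplicity S = 3 \<and> embedding_dimension S = 3 \<and>
    ns_genus S = g \<and> card (tree_children 3 S) = 1"
proof -
  obtain p q where *: "p + q = g" "1 \<le> p" "1 \<le> q" "p \<le> 2 * q" "q < 2 * p" "q + 1 < p \<or> p < q"
  proof (cases "even g")
    case True
    then obtain k where "g = 2 * k" by (rule evenE)
    then show ?thesis using assms by (intro that[of "k + 1" "k - 1"]) auto
  next
    case False
    then obtain k where "g = 2 * k + 1" by (rule oddE)
    then show ?thesis using assms by (intro that[of k "k + 1"]) auto
  qed
  then have pq: "kunz3 p q" by (simp add: kunz3_def)
  show ?thesis
    using * kunz3_numerical_semigroup[OF pq] embedding_dimension_semigroup3[OF pq]
      ns_genus_semigroup3[of p q] card_tree_children_semigroup3[OF pq]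
    by (intro exI[of _ "semigroup3 p q"]) auto
qed

text \<open>Embedding dimension two means \<open>q = 2 * p\<close>, of genus \<open>3 * p\<close>,
  or \<open>p = 2 * q + 1\<close>, of genus \<open>3 * q + 1\<close>.\<close>

lemma ex_semigroup3_embedding_dimension_2_iff:
  assumes "2 \<le> g"
  shows "(\<exists>S. numerical_semigroup S \<and> ns_multiplicity S = 3 \<and> embedding_dimension S = 2 \<and>
    ns_genus S = g) \<longleftrightarrow> g mod 3 \<in> {0, 1}"
proof
  assume "\<exists>S. numerical_semigroup S \<and> ns_multiplicity S = 3 \<and> embedding_dimension S = 2 \<and>
    ns_genus S = g"
  then obtain p q where pq: "kunz3 p q" and dim: "embedding_dimension (semigroup3 p q) = 2"
    and g: "g = p + q"
    by (metis multiplicity3_cases ns_genus_semigroup3)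
  have "p = 2 * q + 1 \<or> q = 2 * p"
    using dim pq unfolding embedding_dimension_semigroup3[OF pq] kunz3_def
    by (auto split: if_splits)
  then have "g mod 3 = 0 \<or> g mod 3 = 1" unfolding g by presburger
  then show "g mod 3 \<in> {0, 1}" by simp
next
  assume "g mod 3 \<in> {0, 1}"
  then have "g = 3 * (g div 3) \<or> g = 3 * (g div 3) + 1" by simp presburger
  then obtain k where "g = 3 * k \<or> g = 3 * k + 1" by blast
  then obtain p q where *: "p + q = g" "kunz3 p q" "p = 2 * q + 1 \<or> q = 2 * p"
  proof
    assume "g = 3 * k"
    then show ?thesis using assms by (intro that[of k "2 * k"]) (auto simp: kunz3_def)
  next
    assume "g = 3 * k + 1"
    then show ?thesis using assms by (intro that[of "2 * k + 1" k]) (auto simp: kunz3_def)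
  qed
  then show "\<exists>S. numerical_semigroup S \<and> ns_multiplicity S = 3 \<and> embedding_dimension S = 2 \<and>
    ns_genus S = g"
    using kunz3_numerical_semigroup[OF *(2)] embedding_dimension_semigroup3[OF *(2)]
      ns_genus_semigroup3[of p q]
    by (intro exI[of _ "semigroup3 p q"]) auto
qed

text \<open>A child exists only if both generators are present. The child conditions then reduce to
  \<open>q \<le> p\<close> and \<open>p \<le> q + 1\<close>, of which at least one holds, and both
  hold exactly when the Frobenius number is the smaller side.\<close>

lemma semigroup3_children_iff:
  assumes "kunz3 p q"
  shows "card (tree_children 3 (semigroup3 p q)) = 1 \<longleftrightarrow>
      maximal_embedding_dimension (semigroup3 p q) \<and>
      real_of_int (ns_frobenius (semigroup3 p q)) > 3 * real (ns_genus (semigroup3 p q)) / 2"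
    and "card (tree_children 3 (semigroup3 p q)) = 2 \<longleftrightarrow>
      maximal_embedding_dimension (semigroup3 p q) \<and>
      real_of_int (ns_frobenius (semigroup3 p q)) < 3 * real (ns_genus (semigroup3 p q)) / 2"
  using assms
  unfolding card_tree_children_semigroup3[OF assms] frobenius_genus_semigroup3[OF assms]
    maximal_embedding_dimension_semigroup3[OF assms]
  by (auto simp: kunz3_def)

text \<open>As \<open>g\<close> grows by one, both ends of the interval for \<open>p\<close> move up
  by one if \<open>g\<close> has residue 0, neither moves for residue 1, and only the upper end
  moves for residue 2.\<close>

lemma card_semigroups_mg_3_Suc:
  assumes "2 \<le> g"
  shows "card (semigroups_mg 3 (g + 1)) =
    (if g mod 3 \<in> {0, 1} then card (semigroups_mg 3 g) else card (semigroups_mg 3 g) + 1)"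
proof -
  have "2 \<le> g + 1" using assms by simp
  note card = card_semigroups_mg_3[OF assms] card_semigroups_mg_3[OF \<open>2 \<le> g + 1\<close>]
  show ?thesis
  proof (cases g rule: nat_mod_3_cases)
    case (zero k)
    have "(2 * g + 1) div 3 = 2 * k" "(g + 2) div 3 = k"
      "(2 * (g + 1) + 1) div 3 = 2 * k + 1" "(g + 1 + 2) div 3 = k + 1" "g mod 3 = 0"
      unfolding zero by presburger+
    then show ?thesis by (simp only: card) simp
  next
    case (one k)
    have "(2 * g + 1) div 3 = 2 * k + 1" "(g + 2) div 3 = k + 1"
      "(2 * (g + 1) + 1) div 3 = 2 * k + 1" "(g + 1 + 2) div 3 = k + 1" "g mod 3 = 1"
      unfolding one by presburger+
    then show ?thesis by (simp only: card) simp
  next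
    case (two k)
    have "(2 * g + 1) div 3 = 2 * k + 1" "(g + 2) div 3 = k + 1"
      "(2 * (g + 1) + 1) div 3 = 2 * k + 2" "(g + 1 + 2) div 3 = k + 1" "g mod 3 = 2"
      unfolding two by presburger+
    then show ?thesis by (simp only: card) simp
  qed
qed

theorem theorem2p8:
  shows
    "(\<forall>S. numerical_semigroup S \<longrightarrow> ns_multiplicity S = 3 \<longrightarrow>
        (tree_leaf 3 S \<longleftrightarrow> embedding_dimension S = 2) \<and>
        (card (tree_children 3 S) = 1 \<longleftrightarrow>
           maximal_embedding_dimension S \<and>
           real_of_int (ns_frobenius S) > 3 * real (ns_genus S) / 2) \<and>
        (card (tree_children 3 S) = 2 \<longleftrightarrow>
           maximal_embedding_dimension S \<and>
           real_of_int (ns_frobenius S) < 3 * real (ns_genus S) / 2)) \<and>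
     (\<forall>g::nat. g \<ge> 5 \<longrightarrow>
        (\<exists>S. numerical_semigroup S \<and> ns_multiplicity S = 3 \<and> embedding_dimension S = 3 \<and>
           ns_genus S = g \<and> card (tree_children 3 S) = 2) \<and>
        ((\<exists>S. numerical_semigroup S \<and> ns_multiplicity S = 3 \<and> embedding_dimension S = 2 \<and>
            ns_genus S = g) \<longleftrightarrow> g mod 3 \<in> {0, 1}) \<and>
        (\<forall>S. numerical_semigroup S \<and> ns_multiplicity S = 3 \<and> embedding_dimension S = 2 \<and>
            ns_genus S = g \<longrightarrow> tree_leaf 3 S) \<and>
        (\<exists>S. numerical_semigroup S \<and> ns_multiplicity S = 3 \<and> embedding_dimension S = 3 \<and>
           ns_genus S = g \<and> card (tree_children 3 S) = 1) \<and>
        card (semigroups_mg 3 (g + 1)) =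
          (if g mod 3 \<in> {0, 1} then card (semigroups_mg 3 g)
           else card (semigroups_mg 3 g) + 1))"
proof (intro conjI allI impI)
  fix S assume "numerical_semigroup S" "ns_multiplicity S = 3"
  then obtain p q where pq: "kunz3 p q" and S: "S = semigroup3 p q"
    by (rule multiplicity3_cases)
  show "tree_leaf 3 S \<longleftrightarrow> embedding_dimension S = 2"
    unfolding S by (rule tree_leaf_semigroup3_iff[OF pq])
  show "card (tree_children 3 S) = 1 \<longleftrightarrow> maximal_embedding_dimension S \<and>
      real_of_int (ns_frobenius S) > 3 * real (ns_genus S) / 2"
    unfolding S by (rule semigroup3_children_iff(1)[OF pq])
  show "card (tree_children 3 S) = 2 \<longleftrightarrow> maximal_embedding_dimension S \<and>
      real_of_int (ns_frobenius S) < 3 * real (ns_genus S) / 2"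
    unfolding S by (rule semigroup3_children_iff(2)[OF pq])
next
  fix g :: nat assume "5 \<le> g"
  then have "2 \<le> g" by simp
  show "\<exists>S. numerical_semigroup S \<and> ns_multiplicity S = 3 \<and> embedding_dimension S = 3 \<and>
      ns_genus S = g \<and> card (tree_children 3 S) = 2"
    by (rule ex_semigroup3_two_children[OF \<open>2 \<le> g\<close>])
  show "(\<exists>S. numerical_semigroup S \<and> ns_multiplicity S = 3 \<and> embedding_dimension S = 2 \<and>
      ns_genus S = g) \<longleftrightarrow> g mod 3 \<in> {0, 1}"
    by (rule ex_semigroup3_embedding_dimension_2_iff[OF \<open>2 \<le> g\<close>])
  show "tree_leaf 3 S" if "numerical_semigroup S \<and> ns_multiplicity S = 3 \<and>
      embedding_dimension S = 2 \<and> ns_genus S = g" for S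
  proof -
    from that have "numerical_semigroup S" "ns_multiplicity S = 3" by simp_all
    then obtain p q where pq: "kunz3 p q" and S: "S = semigroup3 p q"
      by (rule multiplicity3_cases)
    show ?thesis using that tree_leaf_semigroup3_iff[OF pq] by (simp add: S)
  qed
  show "\<exists>S. numerical_semigroup S \<and> ns_multiplicity S = 3 \<and> embedding_dimension S = 3 \<and>
      ns_genus S = g \<and> card (tree_children 3 S) = 1"
    by (rule ex_semigroup3_one_child[OF \<open>5 \<le> g\<close>])
  show "card (semigroups_mg 3 (g + 1)) =
      (if g mod 3 \<in> {0, 1} then card (semigroups_mg 3 g) else card (semigroups_mg 3 g) + 1)"
    by (rule card_semigroups_mg_3_Suc[OF \<open>2 \<le> g\<close>])
qed

end
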